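(* Let $p$ be a prime and let $f(n)=c(an+b)$, where $a,b\in\mathbb{Z}$, $\gcd(a,b)=1$, $c\in\mathbb{Q}$, and $a,c\neq 0$. Consider the $p$-adic valuation tree of $\{\nu_p(f(n))\}_{n\ge 0}$. If $-\frac{b}{a}\in\mathbb{Z}_p$, then, for every $k\ge 0$, a non-terminating node at the $k$-th level splits into $p-1$ terminating nodes with valuation $\nu_p(c)+k$ and one non-terminating node with valuation at least $\nu_p(c)+k+1$. If $-\frac{b}{a}\notin\mathbb{Z}_p$, then the tree is a single terminating node with valuation $\nu_p(c)$.
   Context: For a prime $p$, $\nu_p$ is the usual $p$-adic valuation on $\mathbb{Q}$, with $\nu_p(0)=+\infty$; $\mathbb{Z}_p$ is the ring of $p$-adic integers. Valuation tree. Given a sequence of rational numbers $\{S_n\}_{n\ge 0}$, the $p$-adic valuation tree of $\{\nu_p(S_n)\}_{n\ge 0}$ is built as follows. The $0$-th level has a single node, containing all terms of the sequence. A node at level $k$ consists of the terms $S_m$ whose index $m$ has the form $m=c_0+c_1p+\cdots+c_{k-1}p^{k-1}+np^k$, $n\ge 0$, for fixed digits $0\le c_i\le p-1$. A node is terminating if $\nu_p(S_m)$ has the same value for all terms $S_m$ in the node (this common value is "the valuation" of the node); it is non-terminating if at least two terms in the node have different valuations. A terminating node does not split. A non-terminating node at level $k$ splits into the $p$ nodes at level $k+1$ whose indices are $m=c_0+\cdots+c_{k-1}p^{k-1}+c_kp^k+np^{k+1}$, $n\ge 0$, one for each $0\le c_k\le p-1$. A node has "valuation at least $v$" if $\nu_p(S_m)\ge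 v$ for all terms $S_m$ in it. *)

theory Defs
  imports
    Complex_Main
    "HOL-Computational_Algebra.Primes"
    "HOL-Library.Extended"
begin

(* Only the constructors Fin and Pinf occur as values; Pinf is the valuation of 0. *)
definition padic_val :: "nat \<Rightarrow> rat \<Rightarrow> int extended" where
  "padic_val p x =
     (if x = 0 then Pinf
      else Fin (int (multiplicity (int p) (fst (quotient_of x)))
                - int (multiplicity (int p) (snd (quotient_of x)))))"

(* The ring of p-adic integers as the inverse limit of the rings of residues modulo p ^ k:
   the k-th component is the canonical representative of the residue modulo p ^ k, and the
   ring operations are componentwise, modulo p ^ k. *)
definition padic_ints :: "nat \<Rightarrow> (nat \<Rightarrow> int) set" where
  "padic_ints p =
     {z. \<forall>k. 0 \<le> z k \<and> z k < int p ^ k \<and> z (Suc k) mod int p ^ k = z k}"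

definition padic_of_int :: "nat \<Rightarrow> int \<Rightarrow> nat \<Rightarrow> int" where
  "padic_of_int p m = (\<lambda>k. m mod int p ^ k)"

definition padic_mult :: "nat \<Rightarrow> (nat \<Rightarrow> int) \<Rightarrow> (nat \<Rightarrow> int) \<Rightarrow> nat \<Rightarrow> int" where
  "padic_mult p y z = (\<lambda>k. (y k * z k) mod int p ^ k)"

(* A rational u / d, viewed in the fraction field of the p-adic integers, is a p-adic
   integer iff d * z = u has a solution z in the ring of p-adic integers. *)
definition rat_in_padic_ints :: "nat \<Rightarrow> rat \<Rightarrow> bool" where
  "rat_in_padic_ints p x \<longleftrightarrow>
     (\<exists>z \<in> padic_ints p.
        padic_mult p (padic_of_int p (snd (quotient_of x))) z
          = padic_of_int p (fst (quotient_of x)))"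

(* A node at level k is encoded by its list of digits [c_0, ..., c_(k-1)], lowest digit
   first, so the level of a node is the length of the list. *)
definition node_indices :: "nat \<Rightarrow> nat list \<Rightarrow> nat set" where
  "node_indices p cs =
     {m. \<exists>n. m = (\<Sum>i<length cs. cs ! i * p ^ i) + n * p ^ length cs}"

definition terminating :: "nat \<Rightarrow> (nat \<Rightarrow> rat) \<Rightarrow> nat list \<Rightarrow> bool" where
  "terminating p S cs \<longleftrightarrow>
     (\<forall>m \<in> node_indices p cs. \<forall>m' \<in> node_indices p cs.
        padic_val p (S m) = padic_val p (S m'))"

definition node_has_valuation ::
    "nat \<Rightarrow> (nat \<Rightarrow> rat) \<Rightarrow> nat list \<Rightarrow> int extended \<Rightarrow> bool" where
  "node_has_valuation p S cs v \<longleftrightarrow> (\<forall>m \<in> node_indices p cs. padic_val p (S m) = v)"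

definition node_valuation_at_least ::
    "nat \<Rightarrow> (nat \<Rightarrow> rat) \<Rightarrow> nat list \<Rightarrow> int extended \<Rightarrow> bool" where
  "node_valuation_at_least p S cs v \<longleftrightarrow> (\<forall>m \<in> node_indices p cs. v \<le> padic_val p (S m))"

definition children :: "nat \<Rightarrow> nat list \<Rightarrow> nat list set" where
  "children p cs = {cs @ [d] | d. d < p}"

inductive_set valuation_tree :: "nat \<Rightarrow> (nat \<Rightarrow> rat) \<Rightarrow> nat list set"
  for p :: nat and S :: "nat \<Rightarrow> rat" where
  root: "[] \<in> valuation_tree p S"
| split: "cs \<in> valuation_tree p S \<Longrightarrow> \<not> terminating p S cs \<Longrightarrow> cs' \<in> children p cs
          \<Longrightarrow> cs' \<in> valuation_tree p S"

definition nonterminating_nodes :: "nat \<Rightarrow> (nat \<Rightarrow> rat) \<Rightarrow> nat \<Rightarrow> nat list set" where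
  "nonterminating_nodes p S k =
     {cs \<in> valuation_tree p S. length cs = k \<and> \<not> terminating p S cs}"

end

theory Submission
  imports Defs "HOL-Number_Theory.Cong"
begin

text \<open>
  The valuation of \<open>c (a n + b)\<close> is \<open>\<nu>\<^sub>p c\<close> plus that of the integer \<open>a n + b\<close>, so only divisibility
  of \<open>a n + b\<close> by powers of \<open>p\<close> matters. As \<open>a\<close> and \<open>b\<close> are coprime, \<open>- b / a\<close> is a \<open>p\<close>-adic integer
  exactly when \<open>p\<close> does not divide \<open>a\<close> (lemma \<open>rat_in_padic_ints_minus_divide_iff\<close>).

  If \<open>p\<close> divides \<open>a\<close>, it does not divide \<open>b\<close>, hence no \<open>a n + b\<close>, and every term has valuation
  \<open>\<nu>\<^sub>p c\<close>.

  If \<open>p\<close> does not divide \<open>a\<close>, consider a node at level \<open>k\<close> with smallest index \<open>s\<close>; its indices are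
  \<open>s + n p\<^sup>k\<close>. If \<open>p\<^sup>k\<close> does not divide \<open>a s + b\<close>, all the integers \<open>a (s + n p\<^sup>k) + b\<close> are congruent
  modulo \<open>p\<^sup>k\<close> and have the same valuation, which is below \<open>k\<close>. If \<open>a s + b = p\<^sup>k t\<close>, they are the
  numbers \<open>p\<^sup>k (t + a n)\<close>, and \<open>p\<close> divides \<open>t + a n\<close> for precisely one residue class of \<open>n\<close>
  modulo \<open>p\<close>. So a node is non-terminating iff \<open>p\<^sup>k\<close> divides \<open>a s + b\<close> (lemma
  \<open>nonterminating_affine_iff\<close>). Exactly one child of such a node satisfies the same condition at level
  \<open>k + 1\<close>, while in each of the other children all the integers have valuation exactly \<open>k\<close>.
\<close>

section \<open>Valuations of rationals and integers\<close>

lemma padic_val_divide: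
  assumes "prime p" and "u \<noteq> 0" and "v \<noteq> 0"
  shows "padic_val p (of_int u / of_int v) =
    Fin (int (multiplicity (int p) u) - int (multiplicity (int p) v))"
proof -
  let ?x = "of_int u / of_int v :: rat"
  obtain n d where q: "quotient_of ?x = (n, d)"
    by fastforce
  have d: "d > 0" and x: "?x = of_int n / of_int d"
    using q by (auto intro: quotient_of_denom_pos quotient_of_div)
  have n: "n \<noteq> 0"
    using assms x by auto
  have "(of_int (u * d) :: rat) = of_int (n * v)"
    using x d assms by (simp add: field_simps)
  then have "u * d = n * v"
    by (simp only: of_int_eq_iff)
  then have "multiplicity (int p) (u * d) = multiplicity (int p) (n * v)"
    by simp
  then have "multiplicity (int p) u + multiplicity (int p) d
      = multiplicity (int p) n + multiplicity (int p) v"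
    using assms n d by (simp add: prime_elem_multiplicity_mult_distrib)
  then show ?thesis
    using assms by (auto simp: padic_val_def q)
qed

lemma padic_val_of_int:
  "prime p \<Longrightarrow>
    padic_val p (of_int m) = (if m = 0 then Pinf else Fin (int (multiplicity (int p) m)))"
  using padic_val_divide[of p m 1] by (auto simp: padic_val_def)

lemma padic_val_mult_of_int:
  assumes "prime p" and "c \<noteq> 0"
  shows "padic_val p (c * of_int m) = padic_val p c + padic_val p (of_int m)"
proof (cases "m = 0")
  case True
  then show ?thesis
    using assms by (simp add: padic_val_def)
next
  case False
  obtain u v where q: "quotient_of c = (u, v)"
    by fastforce
  have v: "v > 0" and c: "c = of_int u / of_int v"
    using q by (auto intro: quotient_of_denom_pos quotient_of_div)
  have u: "u \<noteq> 0"
    using assms c by auto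
  have "padic_val p (c * of_int m) = padic_val p (of_int (u * m) / of_int v)"
    by (simp add: c)
  also have "\<dots> = padic_val p c + padic_val p (of_int m)"
    using assms u v False
    by (simp add: c padic_val_divide padic_val_of_int prime_elem_multiplicity_mult_distrib
        del: of_int_mult)
  finally show ?thesis .
qed

lemma padic_val_mult_of_int_eq_iff:
  assumes "prime p" and "c \<noteq> 0"
  shows "padic_val p (c * of_int m) = padic_val p c + y \<longleftrightarrow> padic_val p (of_int m) = y"
  using assms(2) unfolding padic_val_mult_of_int[OF assms]
  by (cases y; cases "padic_val p (of_int m)") (auto simp: padic_val_def)

lemma le_padic_val_mult_of_int_iff:
  assumes "prime p" and "c \<noteq> 0"
  shows "padic_val p c + y \<le> padic_val p (c * of_int m) \<longleftrightarrow> y \<le> padic_val p (of_int m)"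
  using assms(2) unfolding padic_val_mult_of_int[OF assms]
  by (cases y; cases "padic_val p (of_int m)") (auto simp: padic_val_def)

lemma le_padic_val_of_int_iff:
  assumes "prime p"
  shows "Fin (int k) \<le> padic_val p (of_int m) \<longleftrightarrow> int p ^ k dvd m"
proof -
  have "\<not> is_unit (int p)"
    using assms by (auto simp: prime_nat_iff)
  then show ?thesis
    using assms by (auto simp: padic_val_of_int power_dvd_iff_le_multiplicity)
qed

lemma padic_val_of_int_eq_iff:
  assumes "prime p"
  shows "padic_val p (of_int m) = Fin (int k) \<longleftrightarrow> int p ^ k dvd m \<and> \<not> int p ^ Suc k dvd m"
  unfolding le_padic_val_of_int_iff[OF assms, symmetric]
  using assms by (auto simp: padic_val_of_int)

section \<open>Rational p-adic integers\<close>

lemma coprime_int_primeI: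
  assumes "prime p" and "\<not> int p dvd d"
  shows "coprime d (int p)"
  using assms prime_imp_coprime[of "int p" d] by (simp add: coprime_commute)

lemma rat_in_padic_ints_iff:
  assumes p: "prime p"
  shows "rat_in_padic_ints p x \<longleftrightarrow> \<not> int p dvd snd (quotient_of x)"
proof -
  obtain u d where q: "quotient_of x = (u, d)"
    by fastforce
  have cop: "coprime u d"
    using quotient_of_coprime[OF q] .
  have pp: "prime (int p)"
    using p by simp
  have p0: "int p ^ k > 0" for k
    using p by (simp add: prime_gt_0_nat)
  have "rat_in_padic_ints p x" if nd: "\<not> int p dvd d"
  proof -
    have cd: "coprime d (int p ^ k)" for k
      using coprime_int_primeI[OF p nd] by simp
    have "\<exists>y. \<forall>k. [d * y k = 1] (mod int p ^ k)"
      using cong_solve_coprime_int[OF cd] by metis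
    then obtain y where y: "\<And>k. [d * y k = 1] (mod int p ^ k)"
      by blast
    define z where "z k = (u * y k) mod int p ^ k" for k
    have sol: "[d * z k = u] (mod int p ^ k)" for k
    proof -
      have "[d * z k = (d * y k) * u] (mod int p ^ k)"
        unfolding z_def mult.assoc
        by (simp add: cong_def mod_mult_right_eq mult.left_commute mult.commute)
      also have "[(d * y k) * u = 1 * u] (mod int p ^ k)"
        by (intro cong_mult y) simp
      finally show ?thesis
        by simp
    qed
    have compat: "z (Suc k) mod int p ^ k = z k" for k
    proof -
      have "[d * z (Suc k) = u] (mod int p ^ k)"
        by (rule cong_dvd_modulus[OF sol]) simp
      then have "[d * z (Suc k) = d * z k] (mod int p ^ k)"
        using sol[of k] by (metis cong_trans cong_sym)
      then have "[z (Suc k) = z k] (mod int p ^ k)"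
        using cd by (simp add: cong_mult_lcancel)
      then show ?thesis
        by (simp add: cong_def z_def)
    qed
    have "0 \<le> z k \<and> z k < int p ^ k" for k
      using p0[of k] by (simp add: z_def)
    then have "z \<in> padic_ints p"
      using compat by (simp add: padic_ints_def)
    moreover have "padic_mult p (padic_of_int p d) z = padic_of_int p u"
      using sol by (simp add: padic_mult_def padic_of_int_def cong_def mod_mult_left_eq)
    ultimately show ?thesis
      by (auto simp: rat_in_padic_ints_def q)
  qed
  moreover have False if dd: "int p dvd d" and x: "rat_in_padic_ints p x"
  proof -
    obtain z where "padic_mult p (padic_of_int p d) z = padic_of_int p u"
      using x by (auto simp: rat_in_padic_ints_def q)
    \<comment> \<open>Modulo \<open>p\<close> the equation \<open>d z = u\<close> becomes \<open>0 = u\<close>.\<close>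
    from fun_cong[OF this, of 1] have "int p dvd u"
      using dd by (simp add: padic_mult_def padic_of_int_def dvd_eq_mod_eq_0)
    then show False
      using dd cop pp by (meson coprime_common_divisor not_prime_unit)
  qed
  ultimately show ?thesis
    unfolding q snd_conv by blast
qed

lemma rat_in_padic_ints_minus_divide_iff:
  assumes p: "prime p" and cop: "coprime a b" and a: "a \<noteq> 0"
  shows "rat_in_padic_ints p (- (of_int b / of_int a)) \<longleftrightarrow> \<not> int p dvd a"
proof -
  have "- (of_int b / of_int a) = Fract (- b) a"
    by (simp add: Fract_of_int_quotient)
  then have "quotient_of (- (of_int b / of_int a)) = Rat.normalize (- b, a)"
    by (simp add: quotient_of_Fract)
  moreover have "gcd b a = 1"
    using cop by (simp add: gcd.commute)
  ultimately have "snd (quotient_of (- (of_int b / of_int a))) = \<bar>a\<bar>"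
    using a by (auto simp: Rat.normalize_def Let_def)
  then show ?thesis
    using p by (simp add: rat_in_padic_ints_iff)
qed

section \<open>Valuation trees of affine sequences\<close>

text \<open>The smallest index in a node.\<close>

definition node_offset :: "nat \<Rightarrow> nat list \<Rightarrow> nat" where
  "node_offset p cs = (\<Sum>i<length cs. cs ! i * p ^ i)"

lemma node_offset_Nil [simp]: "node_offset p [] = 0"
  by (simp add: node_offset_def)

lemma node_offset_snoc [simp]:
  "node_offset p (cs @ [d]) = node_offset p cs + d * p ^ length cs"
  by (simp add: node_offset_def nth_append)

lemma node_indices_eq: "node_indices p cs = range (\<lambda>n. node_offset p cs + n * p ^ length cs)"
  by (auto simp: node_indices_def node_offset_def)

lemma affine_node_index:
  fixes a b :: int
  shows "a * int (node_offset p cs + n * p ^ length cs) + b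
    = (a * int (node_offset p cs) + b) + int p ^ length cs * (a * int n)"
  by (simp add: algebra_simps)

lemma terminating_affineI:
  fixes a b :: int
  assumes p: "prime p" and c: "c \<noteq> 0"
    and nd: "\<not> int p ^ length cs dvd a * int (node_offset p cs) + b"
  shows "terminating p (\<lambda>n. c * of_int (a * int n + b)) cs"
proof -
  let ?s = "a * int (node_offset p cs) + b"
  have "?s \<noteq> 0"
    using nd by (metis dvd_0_right)
  then obtain j where j: "padic_val p (of_int ?s) = Fin (int j)"
    using padic_val_of_int[OF p, of ?s] by simp
  then have js: "int p ^ j dvd ?s" "\<not> int p ^ Suc j dvd ?s"
    using padic_val_of_int_eq_iff[OF p] by blast+
  have "j < length cs"
    using nd js(1) by (meson not_less le_imp_power_dvd dvd_trans)
  then have dv: "int p ^ j dvd int p ^ length cs" "int p ^ Suc j dvd int p ^ length cs"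
    by (simp_all add: le_imp_power_dvd del: power_Suc)
  have "padic_val p (c * of_int (a * int m + b)) = padic_val p c + Fin (int j)"
    if m: "m \<in> node_indices p cs" for m
  proof -
    obtain n where n: "m = node_offset p cs + n * p ^ length cs"
      using m by (auto simp: node_indices_eq)
    have "int p ^ j dvd a * int m + b" "\<not> int p ^ Suc j dvd a * int m + b"
      unfolding n affine_node_index
      using js dv by (simp_all add: dvd_add_left_iff del: power_Suc)
    then show ?thesis
      unfolding padic_val_mult_of_int_eq_iff[OF p c] padic_val_of_int_eq_iff[OF p] by blast
  qed
  then show ?thesis
    by (simp add: terminating_def del: of_int_add of_int_mult)
qed

lemma prime_affine_root_unique:
  fixes a t :: int
  assumes p: "prime p" and a: "\<not> int p dvd a"
  shows "\<exists>!d. d < p \<and> int p dvd t + a * int d"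
proof (rule ex_ex1I)
  have p0: "int p > 0"
    using p by (simp add: prime_gt_0_nat)
  obtain y where y: "[a * y = 1] (mod int p)"
    using cong_solve_coprime_int[OF coprime_int_primeI[OF p a]] by blast
  define d where "d = nat ((- t * y) mod int p)"
  have d: "int d = (- t * y) mod int p"
    using p0 by (simp add: d_def)
  then have "d < p"
    using p0 by (metis of_nat_less_iff pos_mod_bound)
  moreover have "[t + a * int d = t + a * (- t * y)] (mod int p)"
    unfolding d by (intro cong_add cong_mult cong_refl cong_mod_leftI)
  then have "[t + a * int d = t + (a * y) * (- t)] (mod int p)"
    by (simp add: mult_ac)
  then have "[t + a * int d = t + 1 * (- t)] (mod int p)"
    by (rule cong_trans) (intro cong_add cong_mult y cong_refl)
  then have "int p dvd t + a * int d"
    by (simp add: cong_0_iff)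
  ultimately show "\<exists>d. d < p \<and> int p dvd t + a * int d"
    by blast
next
  fix d e
  assume d: "d < p \<and> int p dvd t + a * int d" and e: "e < p \<and> int p dvd t + a * int e"
  then have "int p dvd (t + a * int d) - (t + a * int e)"
    by (meson dvd_diff)
  then have "int p dvd a * (int d - int e)"
    by (simp add: algebra_simps)
  then have "int p dvd int d - int e"
    using p a by (simp add: prime_dvd_mult_iff)
  then have "[d = e] (mod p)"
    by (simp add: cong_iff_dvd_diff flip: cong_int_iff)
  then show "d = e"
    using d e by (simp add: cong_def)
qed

lemma nonterminating_affine_iff:
  fixes a b :: int
  assumes p: "prime p" and c: "c \<noteq> 0" and a: "\<not> int p dvd a"
  shows "\<not> terminating p (\<lambda>n. c * of_int (a * int n + b)) cs
    \<longleftrightarrow> int p ^ length cs dvd a * int (node_offset p cs) + b"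
proof
  assume dv: "int p ^ length cs dvd a * int (node_offset p cs) + b"
  then obtain t where t: "a * int (node_offset p cs) + b = int p ^ length cs * t" ..
  have val: "padic_val p (of_int (a * int (node_offset p cs + n * p ^ length cs) + b))
      = Fin (int (length cs)) \<longleftrightarrow> \<not> int p dvd t + a * int n" for n
    unfolding padic_val_of_int_eq_iff[OF p] affine_node_index t distrib_left[symmetric] power_Suc2
    using p by (simp add: prime_gt_0_nat)
  obtain d where d: "int p dvd t + a * int d"
    using prime_affine_root_unique[OF p a] by blast
  have suc: "t + a * int (Suc d) = (t + a * int d) + a"
    by (simp add: algebra_simps)
  have e: "\<not> int p dvd t + a * int (Suc d)"
    unfolding suc dvd_add_right_iff[OF d] by (rule a)
  show "\<not> terminating p (\<lambda>n. c * of_int (a * int n + b)) cs"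
  proof
    let ?v = "\<lambda>n. a * int (node_offset p cs + n * p ^ length cs) + b"
    assume "terminating p (\<lambda>n. c * of_int (a * int n + b)) cs"
    then have "padic_val p (c * of_int (?v d)) = padic_val p (c * of_int (?v (Suc d)))"
      unfolding terminating_def node_indices_eq by blast
    also have "\<dots> = padic_val p c + padic_val p (of_int (?v (Suc d)))"
      by (rule padic_val_mult_of_int[OF p c])
    finally have "padic_val p (of_int (?v d)) = padic_val p (of_int (?v (Suc d)))"
      unfolding padic_val_mult_of_int_eq_iff[OF p c] .
    then show False
      using val[of d] val[of "Suc d"] d e by simp
  qed
qed (use terminating_affineI[OF p c] in blast)

lemma node_valuation_at_least_affine:
  fixes a b :: int
  assumes p: "prime p" and c: "c \<noteq> 0"
    and dv: "int p ^ length cs dvd a * int (node_offset p cs) + b"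
  shows "node_valuation_at_least p (\<lambda>n. c * of_int (a * int n + b)) cs
    (padic_val p c + Fin (int (length cs)))"
  unfolding node_valuation_at_least_def node_indices_eq
    le_padic_val_mult_of_int_iff[OF p c] le_padic_val_of_int_iff[OF p]
  using dv by (auto simp: affine_node_index simp del: of_nat_add of_nat_mult)

text \<open>
  The child \<open>cs @ [d]\<close> has level \<open>length cs + 1\<close>; that \<open>a n + b\<close> is not divisible by \<open>p\<close> to this power
  need only be checked at its smallest index.
\<close>

lemma node_has_valuation_affine_child:
  fixes a b :: int
  assumes p: "prime p" and c: "c \<noteq> 0"
    and dv: "int p ^ length cs dvd a * int (node_offset p cs) + b"
    and nd: "\<not> int p ^ Suc (length cs) dvd a * int (node_offset p (cs @ [d])) + b"
  shows "node_has_valuation p (\<lambda>n. c * of_int (a * int n + b)) (cs @ [d])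
    (padic_val p c + Fin (int (length cs)))"
proof -
  let ?k = "length cs"
  have "int p ^ ?k dvd a * int m + b \<and> \<not> int p ^ Suc ?k dvd a * int m + b"
    if m: "m \<in> node_indices p (cs @ [d])" for m
  proof -
    obtain n where n: "m = node_offset p (cs @ [d]) + n * p ^ length (cs @ [d])"
      using m unfolding node_indices_eq by blast
    have eq: "a * int m + b
        = (a * int (node_offset p (cs @ [d])) + b) + int p ^ Suc ?k * (a * int n)"
      unfolding n affine_node_index by simp
    have off: "a * int (node_offset p (cs @ [d])) + b
        = (a * int (node_offset p cs) + b) + int p ^ ?k * (a * int d)"
      unfolding node_offset_snoc affine_node_index ..
    have "int p ^ ?k dvd a * int m + b"
      unfolding eq off using dv by simp
    moreover have "\<not> int p ^ Suc ?k dvd a * int m + b"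
      unfolding eq using nd by (simp add: dvd_add_left_iff del: power_Suc node_offset_snoc)
    ultimately show ?thesis ..
  qed
  then show ?thesis
    unfolding node_has_valuation_def padic_val_mult_of_int_eq_iff[OF p c]
      padic_val_of_int_eq_iff[OF p] by blast
qed

lemma nonterminating_affine_child_unique:
  fixes a b :: int
  assumes p: "prime p" and c: "c \<noteq> 0" and a: "\<not> int p dvd a"
    and nt: "\<not> terminating p (\<lambda>n. c * of_int (a * int n + b)) cs"
  shows "\<exists>!d. d < p \<and> \<not> terminating p (\<lambda>n. c * of_int (a * int n + b)) (cs @ [d])"
proof -
  obtain t where t: "a * int (node_offset p cs) + b = int p ^ length cs * t"
    using nt unfolding nonterminating_affine_iff[OF p c a] ..
  have "int p ^ length (cs @ [d]) dvd a * int (node_offset p (cs @ [d])) + b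
      \<longleftrightarrow> int p dvd t + a * int d" for d
    unfolding node_offset_snoc affine_node_index t distrib_left[symmetric] length_append_singleton
      power_Suc2
    using p by (simp add: prime_gt_0_nat)
  then show ?thesis
    unfolding nonterminating_affine_iff[OF p c a]
    using prime_affine_root_unique[OF p a] by presburger
qed

lemma nonterminating_nodes_affine_nonempty:
  fixes a b :: int
  assumes p: "prime p" and c: "c \<noteq> 0" and a: "\<not> int p dvd a"
  shows "nonterminating_nodes p (\<lambda>n. c * of_int (a * int n + b)) k \<noteq> {}"
proof (induction k)
  case 0
  have "\<not> terminating p (\<lambda>n. c * of_int (a * int n + b)) []"
    unfolding nonterminating_affine_iff[OF p c a] by simp
  then show ?case
    using valuation_tree.root unfolding nonterminating_nodes_def by blast
next
  case (Suc k)
  let ?f = "\<lambda>n. c * of_int (a * int n + b)"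
  obtain cs where cs: "cs \<in> valuation_tree p ?f" "length cs = k" "\<not> terminating p ?f cs"
    using Suc unfolding nonterminating_nodes_def by blast
  obtain d where d: "d < p" "\<not> terminating p ?f (cs @ [d])"
    using nonterminating_affine_child_unique[OF p c a cs(3)] by blast
  have "cs @ [d] \<in> children p cs"
    using d(1) by (auto simp: children_def)
  then have "cs @ [d] \<in> valuation_tree p ?f"
    by (rule valuation_tree.split[OF cs(1,3)])
  then show ?case
    using d(2) cs(2) unfolding nonterminating_nodes_def by force
qed

lemma card_children_affine:
  fixes a b :: int
  assumes f: "f = (\<lambda>n. c * of_int (a * int n + b))"
    and p: "prime p" and c: "c \<noteq> 0" and a: "\<not> int p dvd a"
    and nt: "\<not> terminating p f cs"
  shows "card {cs' \<in> children p cs. terminating p f cs' \<and>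
      node_has_valuation p f cs' (padic_val p c + Fin (int (length cs)))} = p - 1"
      (is "card ?T = _")
    and "card {cs' \<in> children p cs. \<not> terminating p f cs' \<and>
      node_valuation_at_least p f cs' (padic_val p c + Fin (int (length cs) + 1))} = 1"
      (is "card ?N = _")
proof -
  have iff: "\<not> terminating p f cs'
      \<longleftrightarrow> int p ^ length cs' dvd a * int (node_offset p cs') + b" for cs'
    unfolding f by (rule nonterminating_affine_iff[OF p c a])
  obtain e where e: "e < p" "\<not> terminating p f (cs @ [e])"
    and uniq: "\<And>d. d < p \<Longrightarrow> \<not> terminating p f (cs @ [d]) \<Longrightarrow> d = e"
    using nonterminating_affine_child_unique[OF p c a nt[unfolded f]] unfolding f by blast
  have dv: "int p ^ length cs dvd a * int (node_offset p cs) + b"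
    using nt iff by blast
  have val: "node_has_valuation p f (cs @ [d]) (padic_val p c + Fin (int (length cs)))"
    if "terminating p f (cs @ [d])" for d
  proof -
    have "\<not> int p ^ Suc (length cs) dvd a * int (node_offset p (cs @ [d])) + b"
      using that iff[of "cs @ [d]"] unfolding length_append_singleton by blast
    then show ?thesis
      unfolding f by (rule node_has_valuation_affine_child[OF p c dv])
  qed
  have "int p ^ length (cs @ [e]) dvd a * int (node_offset p (cs @ [e])) + b"
    using e(2) iff by blast
  from node_valuation_at_least_affine[OF p c this]
  have low: "node_valuation_at_least p f (cs @ [e]) (padic_val p c + Fin (int (length cs) + 1))"
    unfolding f by (simp add: add.commute)
  have "?T = (\<lambda>d. cs @ [d]) ` ({..<p} - {e})"
    unfolding children_def using e uniq val by blast
  then show "card ?T = p - 1"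
    using e(1) by (simp add: card_image inj_on_def)
  have "?N = {cs @ [e]}"
    unfolding children_def using e uniq low by blast
  then show "card ?N = 1"
    by simp
qed

lemma valuation_tree_terminating_root:
  assumes "terminating p S []"
  shows "valuation_tree p S = {[]}"
proof -
  have "cs = []" if "cs \<in> valuation_tree p S" for cs
    using that by induction (use assms in auto)
  then show ?thesis
    using valuation_tree.root by blast
qed

theorem lemma4p1:
  fixes p :: nat and a b :: int and c :: rat and f :: "nat \<Rightarrow> rat"
  assumes "prime p"
    and "gcd a b = 1"
    and "a \<noteq> 0" and "c \<noteq> 0"
    and f: "\<And>n. f n = c * (of_int a * of_nat n + of_int b)"
  shows "(rat_in_padic_ints p (- (of_int b / of_int a)) \<longrightarrow>
           (\<forall>k::nat.
              nonterminating_nodes p f k \<noteq> {} \<and>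
              (\<forall>cs \<in> nonterminating_nodes p f k.
                 card {cs' \<in> children p cs. terminating p f cs' \<and>
                         node_has_valuation p f cs' (padic_val p c + Fin (int k))} = p - 1 \<and>
                 card {cs' \<in> children p cs. \<not> terminating p f cs' \<and>
                         node_valuation_at_least p f cs' (padic_val p c + Fin (int k + 1))} = 1)))
       \<and> (\<not> rat_in_padic_ints p (- (of_int b / of_int a)) \<longrightarrow>
           valuation_tree p f = {[]} \<and> terminating p f [] \<and>
           node_has_valuation p f [] (padic_val p c))"
proof -
  note p = \<open>prime p\<close> and c = \<open>c \<noteq> 0\<close>
  have cop: "coprime a b"
    using assms(2) by (simp add: coprime_iff_gcd_eq_1)
  have f': "f = (\<lambda>n. c * of_int (a * int n + b))"
    by (rule ext) (simp add: f)
  note iff = rat_in_padic_ints_minus_divide_iff[OF p cop \<open>a \<noteq> 0\<close>]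
  show ?thesis
  proof (cases "int p dvd a")
    case False
    have "card {cs' \<in> children p cs. terminating p f cs' \<and>
          node_has_valuation p f cs' (padic_val p c + Fin (int k))} = p - 1 \<and>
        card {cs' \<in> children p cs. \<not> terminating p f cs' \<and>
          node_valuation_at_least p f cs' (padic_val p c + Fin (int k + 1))} = 1"
      if "cs \<in> nonterminating_nodes p f k" for k cs
    proof -
      have k: "length cs = k" and nt: "\<not> terminating p f cs"
        using that by (auto simp: nonterminating_nodes_def)
      show ?thesis
        using card_children_affine[OF f' p c False nt] unfolding k by blast
    qed
    moreover have "nonterminating_nodes p f k \<noteq> {}" for k
      unfolding f' by (rule nonterminating_nodes_affine_nonempty[OF p c False])
    ultimately show ?thesis
      using False iff by blast
  next
    case True
    then have "\<not> int p dvd b"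
      using cop p by (meson coprime_common_divisor not_prime_unit prime_nat_int_transfer)
    then have "\<not> int p dvd a * int n + b" for n
      using True by (simp add: dvd_add_right_iff)
    then have "padic_val p (f n) = padic_val p c + Fin (int 0)" for n
      unfolding f' padic_val_mult_of_int_eq_iff[OF p c] padic_val_of_int_eq_iff[OF p] by simp
    then have val: "padic_val p (f n) = padic_val p c" for n
      using c by (simp add: padic_val_def)
    then have "terminating p f []"
      by (simp add: terminating_def)
    then show ?thesis
      using val True iff valuation_tree_terminating_root by (simp add: node_has_valuation_def)
  qed
qed

end
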